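(* For each class $c\in\mathcal C$, define the constants $$D_{\max}^{(c)}\triangleq V\theta_c+d_{\max},\qquad Q_{\max}^{(c)}\triangleq V\theta_c+2d_{\max}.$$ In the $\mathsf{ORA}$ policy, the queues $Q_n^{(c)}(t)$ and $D_n^{(c)}(t)$ are deterministically bounded by $$Q_n^{(c)}(t)\le Q_{\max}^{(c)},\qquad D_n^{(c)}(t)\le D_{\max}^{(c)},\qquad\text{for all }t,\ c,\text{ and }n\ne d_c.$$ In addition, $D_n^{(c)}(t)\ge V\theta_c-d_{\max}$ for all $n\neq d_c$, $c$, and $t$.
   Context: Network model. Finite node set $\mathcal N$, set $\mathcal L$ of directed links, finite set $\mathcal C$ of traffic classes; class $c$ has destination $d_c\in\mathcal N$. Slots $t=0,1,2,\dots$. Exogenous class $c$ arrivals at node $n$ in slot $t$: $A_n^{(c)}(t)\in\{0,\dots,A_{\max}\}$. Link $(n,m)$ has capacity $\mu_{\max}^{nm}$; allocated service rates satisfy $\mu_{nm}^{(c)}(t)\ge0$ and $\sum_c\mu_{nm}^{(c)}(t)\le\mu_{\max}^{nm}$. The class $c$ backlog $Q_n^{(c)}(t)\ge0$ at node $n\ne d_c$ satisfies $Q_n^{(c)}(0)=0$ and $$Q_n^{(c)}(t+1)\le\Big[\big(Q_n^{(c)}(t)-\sum_b\mu_{nb}^{(c)}(t)\big)^+-d_n^{(c)}(t)\Big]^++A_n^{(c)}(t)+\sum_a\mu_{an}^{(c)}(t),\qquad (x)^+=\max(x,0),$$ where $d_n^{(c)}(t)\in[0,d_{\max}]$ is the allocated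 drop rate (and $Q_{d_c}^{(c)}(t)=0$). The packets actually dropped are $\widetilde d_n^{(c)}(t)=\min\big[(Q_n^{(c)}(t)-\sum_b\mu_{nb}^{(c)}(t))^+,\,d_n^{(c)}(t)\big]$. The drop queues satisfy $D_n^{(c)}(0)=V\theta_c$ and $D_n^{(c)}(t+1)=[D_n^{(c)}(t)-\varphi_n^{(c)}(t)]^++\widetilde d_n^{(c)}(t)$ with $\varphi_n^{(c)}(t)\in[0,d_{\max}]$. Let $\mu_{\max}^{\text{in}}=\max_n\sum_{a:(a,n)\in\mathcal L}\mu_{\max}^{an}$. Standing assumption: $d_{\max}\ge A_{\max}+\mu_{\max}^{\text{in}}$. $\mathsf{ORA}$ policy (parameters $V>0$; $\theta_c=a_c$ where $g_c(x)=a_cx$, $a_c>0$), in every slot $t$: (1) Backpressure routing: for each link $l=(n,m)$ with set $\mathcal C_l$ of classes having access to $l$, compute $W_l^{(c)}(t)=Q_n^{(c)}(t)-Q_m^{(c)}(t)$ for $c\in\mathcal C_l$ and let $c_l^*(t)$ maximize $W_l^{(c)}(t)$ over $c\in\mathcal C_l$. Set $\mu_{nm}^{(c_l^*(t))}(t)=\mu_{\max}^{nm}$ if $\max_{c\in\mathcal C_l}W_l^{(c)}(t)>0$ and $0$ otherwise; set $\mu_{nm}^{(c)}(t)=0$ for all other classes. (2) Packet dropping: $d_n^{(c)}(t)=d_{\max}$ if $Q_n^{(c)}(t)>D_n^{(c)}(t)$ and $0$ otherwise; $\varphi_n^{(c)}(t)=d_{\max}$ if $D_n^{(c)}(t)>V\theta_c$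 and $0$ otherwise. (3) Update the queues. *)

theory Defs
  imports Complex_Main
begin

text \<open>A link is an ordered pair (tail, head); \<^term>\<open>access\<close> gives the set of classes that
  may use a link.\<close>

record ('n, 'c) network =
  nodes :: "'n set"
  links :: "('n \<times> 'n) set"
  classes :: "'c set"
  dest :: "'c \<Rightarrow> 'n"
  access :: "'n \<times> 'n \<Rightarrow> 'c set"
  cap :: "'n \<times> 'n \<Rightarrow> real"
  A_max :: nat
  d_max :: real

definition mu_in_max :: "('n, 'c) network \<Rightarrow> real" where
  "mu_in_max G = (MAX n\<in>nodes G. \<Sum>a | (a, n) \<in> links G. cap G (a, n))"

definition network :: "('n, 'c) network \<Rightarrow> bool" where
  "network G \<longleftrightarrow>
     finite (nodes G) \<and> links G \<subseteq> nodes G \<times> nodes G \<and> finite (classes G) \<and>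
     (\<forall>c\<in>classes G. dest G c \<in> nodes G) \<and>
     (\<forall>l\<in>links G. access G l \<subseteq> classes G \<and> 0 \<le> cap G l) \<and>
     real (A_max G) + mu_in_max G \<le> d_max G"

text \<open>Arguments are in the order node, class, slot (for \<^term>\<open>rate\<close>: tail, head, class, slot).
  The fields are the exogenous arrivals, the allocated service rates, the allocated drop rates
  \<open>d\<close>, the drop queue service rates \<open>\<phi>\<close>, the backlogs \<open>Q\<close> and the drop queues \<open>D\<close>.\<close>

record ('n, 'c) evolution =
  arrival :: "'n \<Rightarrow> 'c \<Rightarrow> nat \<Rightarrow> nat"
  rate :: "'n \<Rightarrow> 'n \<Rightarrow> 'c \<Rightarrow> nat \<Rightarrow> real"
  drop_rate :: "'n \<Rightarrow> 'c \<Rightarrow> nat \<Rightarrow> real"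
  phi :: "'n \<Rightarrow> 'c \<Rightarrow> nat \<Rightarrow> real"
  queue :: "'n \<Rightarrow> 'c \<Rightarrow> nat \<Rightarrow> real"
  drop_queue :: "'n \<Rightarrow> 'c \<Rightarrow> nat \<Rightarrow> real"

definition rate_out :: "('n, 'c) network \<Rightarrow> ('n, 'c) evolution \<Rightarrow> 'n \<Rightarrow> 'c \<Rightarrow> nat \<Rightarrow> real" where
  "rate_out G S n c t = (\<Sum>b | (n, b) \<in> links G. rate S n b c t)"

definition rate_in :: "('n, 'c) network \<Rightarrow> ('n, 'c) evolution \<Rightarrow> 'n \<Rightarrow> 'c \<Rightarrow> nat \<Rightarrow> real" where
  "rate_in G S n c t = (\<Sum>a | (a, n) \<in> links G. rate S a n c t)"

definition pos_part :: "real \<Rightarrow> real" where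
  "pos_part x = max x 0"

definition dropped :: "('n, 'c) network \<Rightarrow> ('n, 'c) evolution \<Rightarrow> 'n \<Rightarrow> 'c \<Rightarrow> nat \<Rightarrow> real" where
  "dropped G S n c t =
     min (pos_part (queue S n c t - rate_out G S n c t)) (drop_rate S n c t)"

definition feasible :: "('n, 'c) network \<Rightarrow> ('n, 'c) evolution \<Rightarrow> bool" where
  "feasible G S \<longleftrightarrow>
     (\<forall>n\<in>nodes G. \<forall>c\<in>classes G. \<forall>t. arrival S n c t \<le> A_max G) \<and>
     (\<forall>(n, m)\<in>links G. \<forall>t.
        (\<forall>c\<in>classes G. 0 \<le> rate S n m c t) \<and>
        (\<Sum>c\<in>classes G. rate S n m c t) \<le> cap G (n, m)) \<and>
     (\<forall>c\<in>classes G. \<forall>n\<in>nodes G - {dest G c}. \<forall>t.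
        drop_rate S n c t \<in> {0..d_max G} \<and> phi S n c t \<in> {0..d_max G})"

text \<open>The backlog recursion is only an inequality: a node may hold fewer packets to transmit
  than the rate allocated to it.\<close>

definition queue_dynamics ::
  "('n, 'c) network \<Rightarrow> real \<Rightarrow> ('c \<Rightarrow> real) \<Rightarrow> ('n, 'c) evolution \<Rightarrow> bool" where
  "queue_dynamics G V \<theta> S \<longleftrightarrow>
     (\<forall>c\<in>classes G. \<forall>t. queue S (dest G c) c t = 0) \<and>
     (\<forall>c\<in>classes G. \<forall>n\<in>nodes G - {dest G c}.
        queue S n c 0 = 0 \<and> drop_queue S n c 0 = V * \<theta> c \<and>
        (\<forall>t. 0 \<le> queue S n c t \<and>
             queue S n c (Suc t)
               \<le> pos_part (pos_part (queue S n c t - rate_out G S n c t) - drop_rate S n c t)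
                  + real (arrival S n c t) + rate_in G S n c t \<and>
             drop_queue S n c (Suc t)
               = pos_part (drop_queue S n c t - phi S n c t) + dropped G S n c t))"

definition backpressure_weight ::
  "('n, 'c) evolution \<Rightarrow> 'n \<times> 'n \<Rightarrow> nat \<Rightarrow> 'c \<Rightarrow> real" where
  "backpressure_weight S l t c = queue S (fst l) c t - queue S (snd l) c t"

text \<open>Ties between maximizing classes may be broken arbitrarily, independently for each link
  and slot. A link to which no class has access serves nothing.\<close>

definition backpressure_routing :: "('n, 'c) network \<Rightarrow> ('n, 'c) evolution \<Rightarrow> bool" where
  "backpressure_routing G S \<longleftrightarrow>
     (\<forall>(n, m)\<in>links G. \<forall>t.
        if access G (n, m) = {} then \<forall>c\<in>classes G. rate S n m c t = 0
        else \<exists>c'. is_arg_max (backpressure_weight S (n, m) t) (\<lambda>c. c \<in> access G (n, m)) c' \<and>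
          rate S n m c' t =
            (if (MAX c\<in>access G (n, m). backpressure_weight S (n, m) t c) > 0
             then cap G (n, m) else 0) \<and>
          (\<forall>c\<in>classes G - {c'}. rate S n m c t = 0))"

definition packet_dropping ::
  "('n, 'c) network \<Rightarrow> real \<Rightarrow> ('c \<Rightarrow> real) \<Rightarrow> ('n, 'c) evolution \<Rightarrow> bool" where
  "packet_dropping G V \<theta> S \<longleftrightarrow>
     (\<forall>c\<in>classes G. \<forall>n\<in>nodes G - {dest G c}. \<forall>t.
        drop_rate S n c t = (if queue S n c t > drop_queue S n c t then d_max G else 0) \<and>
        phi S n c t = (if drop_queue S n c t > V * \<theta> c then d_max G else 0))"

definition ORA ::
  "('n, 'c) network \<Rightarrow> real \<Rightarrow> ('c \<Rightarrow> real) \<Rightarrow> ('n, 'c) evolution \<Rightarrow> bool" where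
  "ORA G V \<theta> S \<longleftrightarrow>
     feasible G S \<and> backpressure_routing G S \<and> packet_dropping G V \<theta> S \<and>
     queue_dynamics G V \<theta> S"

definition D_max :: "('n, 'c) network \<Rightarrow> real \<Rightarrow> ('c \<Rightarrow> real) \<Rightarrow> 'c \<Rightarrow> real" where
  "D_max G V \<theta> c = V * \<theta> c + d_max G"

definition Q_max :: "('n, 'c) network \<Rightarrow> real \<Rightarrow> ('c \<Rightarrow> real) \<Rightarrow> 'c \<Rightarrow> real" where
  "Q_max G V \<theta> c = V * \<theta> c + 2 * d_max G"

end

theory Submission
  imports Defs
begin

text \<open>
  Both queues are controlled by a threshold rule whose corrective action at least matches the
  largest possible inflow of a slot, so each can overshoot its threshold by at most one slot's inflow.

  A drop queue receives at most \<open>d_max\<close> per slot and is served at rate \<open>d_max\<close> exactly when it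
  exceeds \<open>V * \<theta> c\<close>; so it never rises above \<open>V * \<theta> c + d_max\<close>. Since it is served only when
  above \<open>V * \<theta> c\<close>, and then by at most \<open>d_max\<close>, it never falls below \<open>V * \<theta> c - d_max\<close>
  (\<open>drop_queue_bounds\<close>).

  A backlog receives at most \<open>A_max + mu_in_max\<close> per slot (\<open>rate_in_le_mu_in_max\<close>), which the
  standing assumption bounds by \<open>d_max\<close>. It is drained by \<open>d_max\<close> whenever it exceeds the drop
  queue, so its threshold is at most the bound \<open>V * \<theta> c + d_max\<close> just found, and the backlog
  overshoots that by at most \<open>d_max\<close> (\<open>backlog_bound\<close>).
\<close>

text \<open>Above \<open>v\<close> the service \<open>d\<close> compensates the arrivals but removes no more than \<open>d\<close>; at or below
  \<open>v\<close> the queue can only grow, to at most \<open>v + d\<close>. The nonnegativity of \<open>v\<close> makes \<open>v + d\<close> large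
  enough for a queue that has just been emptied and then receives a full slot of arrivals.\<close>

lemma drop_queue_bounds:
  fixes D \<phi> x :: "nat \<Rightarrow> real"
  assumes "0 \<le> v" and "0 \<le> d"
    and "D 0 = v"
    and step: "\<And>t. D (Suc t) = pos_part (D t - \<phi> t) + x t"
    and arrivals: "\<And>t. 0 \<le> x t \<and> x t \<le> d"
    and service: "\<And>t. \<phi> t = (if D t > v then d else 0)"
  shows "v - d \<le> D t \<and> D t \<le> v + d"
proof (induction t)
  case 0
  show ?case using assms(1-3) by simp
next
  case (Suc t)
  then show ?case
    using step[of t] arrivals[of t] service[of t] assms(1,2)
    by (auto simp: pos_part_def max_def split: if_splits)
qed

text \<open>Above the threshold the drop rate \<open>d\<close> compensates the inflow, so the bound \<open>B + d\<close> is
  preserved; at or below it the backlog is at most \<open>B\<close>, and adding \<open>d\<close> to its part left after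
  service keeps it within \<open>B + d\<close>.\<close>

lemma backlog_bound:
  fixes Q D r x :: "nat \<Rightarrow> real"
  assumes "0 \<le> B" and "0 \<le> d"
    and "Q 0 = 0"
    and step: "\<And>t. Q (Suc t) \<le> pos_part (pos_part (Q t - r t) - \<delta> t) + x t"
    and service: "\<And>t. 0 \<le> r t"
    and arrivals: "\<And>t. x t \<le> d"
    and drop: "\<And>t. \<delta> t = (if Q t > D t then d else 0)"
    and threshold: "\<And>t. D t \<le> B"
  shows "Q t \<le> B + d"
proof (induction t)
  case 0
  show ?case using assms(1-3) by simp
next
  case (Suc t)
  then show ?case
    using step[of t] service[of t] arrivals[of t] drop[of t] threshold[of t] assms(1,2)
    by (auto simp: pos_part_def max_def split: if_splits)
qed

lemma rate_le_cap:
  assumes "network G" "feasible G S" "(n, m) \<in> links G" "c \<in> classes G"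
  shows "rate S n m c t \<le> cap G (n, m)"
proof -
  have "rate S n m c t \<le> (\<Sum>c\<in>classes G. rate S n m c t)"
    using assms by (intro member_le_sum) (auto simp: network_def feasible_def)
  also have "\<dots> \<le> cap G (n, m)"
    using assms by (auto simp: feasible_def)
  finally show ?thesis .
qed

lemma rate_in_le_mu_in_max:
  assumes "network G" "feasible G S" "n \<in> nodes G" "c \<in> classes G"
  shows "rate_in G S n c t \<le> mu_in_max G"
proof -
  have "rate_in G S n c t \<le> (\<Sum>a | (a, n) \<in> links G. cap G (a, n))"
    unfolding rate_in_def using assms by (intro sum_mono rate_le_cap) auto
  also have "\<dots> \<le> mu_in_max G"
    unfolding mu_in_max_def using assms by (intro Max_ge) (auto simp: network_def)
  finally show ?thesis .
qed

lemma rate_out_nonneg: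
  assumes "feasible G S" "c \<in> classes G"
  shows "0 \<le> rate_out G S n c t"
  unfolding rate_out_def using assms by (intro sum_nonneg) (auto simp: feasible_def)

lemma inflow_le_d_max:
  assumes "network G" "feasible G S" "n \<in> nodes G" "c \<in> classes G"
  shows "real (arrival S n c t) + rate_in G S n c t \<le> d_max G"
proof -
  have "real (arrival S n c t) \<le> real (A_max G)"
    using assms by (auto simp: feasible_def)
  moreover have "real (A_max G) + mu_in_max G \<le> d_max G"
    using assms by (auto simp: network_def)
  ultimately show ?thesis
    using rate_in_le_mu_in_max[OF assms, of t] by linarith
qed

theorem lemma2:
  fixes G :: "('n, 'c) network" and S :: "('n, 'c) evolution"
    and V :: real and a \<theta> :: "'c \<Rightarrow> real" and g :: "'c \<Rightarrow> real \<Rightarrow> real"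
  assumes "network G"
    and "V > 0"
    and "\<And>c. c \<in> classes G \<Longrightarrow> a c > 0"
    and "\<And>c x. c \<in> classes G \<Longrightarrow> g c x = a c * x"
    and "\<And>c. c \<in> classes G \<Longrightarrow> \<theta> c = a c"
    and "ORA G V \<theta> S"
  shows "\<forall>t. \<forall>c\<in>classes G. \<forall>n\<in>nodes G - {dest G c}.
           queue S n c t \<le> Q_max G V \<theta> c \<and>
           drop_queue S n c t \<le> D_max G V \<theta> c \<and>
           drop_queue S n c t \<ge> V * \<theta> c - d_max G"
proof (intro allI ballI)
  fix t c n
  assume c: "c \<in> classes G" and n: "n \<in> nodes G - {dest G c}"
  have feas: "feasible G S" and drop: "packet_dropping G V \<theta> S"
    and dyn: "queue_dynamics G V \<theta> S"
    using assms(6) by (auto simp: ORA_def)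
  have threshold_nonneg: "0 \<le> V * \<theta> c"
    using assms(2) assms(3,5)[OF c] by simp
  have drop_rate: "0 \<le> drop_rate S n c t \<and> drop_rate S n c t \<le> d_max G" for t
    using feas c n by (auto simp: feasible_def)
  then have d_nonneg: "0 \<le> d_max G"
    using order_trans by blast
  have dropped: "0 \<le> dropped G S n c t \<and> dropped G S n c t \<le> d_max G" for t
    using drop_rate[of t] by (auto simp: dropped_def pos_part_def)
  have D: "V * \<theta> c - d_max G \<le> drop_queue S n c t \<and>
      drop_queue S n c t \<le> V * \<theta> c + d_max G" for t
    by (rule drop_queue_bounds[where \<phi> = "phi S n c" and x = "dropped G S n c"])
      (use threshold_nonneg d_nonneg dropped dyn drop c n in
        \<open>auto simp: queue_dynamics_def packet_dropping_def\<close>)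
  have "queue S n c t \<le> (V * \<theta> c + d_max G) + d_max G"
  proof (rule backlog_bound[where D = "drop_queue S n c" and r = "rate_out G S n c"
        and \<delta> = "drop_rate S n c"
        and x = "\<lambda>t. real (arrival S n c t) + rate_in G S n c t"])
    show "real (arrival S n c t) + rate_in G S n c t \<le> d_max G" for t
      using inflow_le_d_max[OF assms(1) feas _ c] n by blast
    show "queue S n c (Suc t)
        \<le> pos_part (pos_part (queue S n c t - rate_out G S n c t) - drop_rate S n c t)
           + (real (arrival S n c t) + rate_in G S n c t)" for t
      using dyn c n by (auto simp: queue_dynamics_def add.assoc)
  qed (use threshold_nonneg d_nonneg D rate_out_nonneg[OF feas c] dyn drop c n in
      \<open>auto simp: queue_dynamics_def packet_dropping_def\<close>)
  then show "queue S n c t \<le> Q_max G V \<theta> c \<and> drop_queue S n c t \<le> D_max G V \<theta> c \<and>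
      drop_queue S n c t \<ge> V * \<theta> c - d_max G"
    using D[of t] by (simp add: Q_max_def D_max_def)
qed

end
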